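(* Let $n$ be a positive integer with $n\equiv 1\pmod 3$. If $n\ge 154$, then a $3$-free $1$-partition of $n$ exists. If $n\ge 3634$, then a $\{2,5\}$-full $1$-partition of $n$ exists.
   Context: For a positive integer $n$, a $1$-partition of $n$ is a finite set $\{a_1,\ldots,a_r\}$ of distinct positive integers with $a_1+\cdots+a_r=n$ and $\frac1{a_1}+\cdots+\frac1{a_r}=1$. It is $3$-free if none of the $a_i$ is divisible by $3$. For a set $P$ of primes, it is $P$-full if all prime factors of all the $a_i$ are contained in $P$ (not every prime of $P$ need occur). *)

theory Defs
  imports Complex_Main "HOL-Computational_Algebra.Primes"
begin

definition one_partition :: "nat \<Rightarrow> nat set \<Rightarrow> bool" where
  "one_partition n A \<longleftrightarrow>
     finite A \<and> (\<forall>a\<in>A. a > 0) \<and> \<Sum>A = n \<and> (\<Sum>a\<in>A. 1 / rat_of_nat a) = 1"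

definition three_free :: "nat set \<Rightarrow> bool" where
  "three_free A \<longleftrightarrow> (\<forall>a\<in>A. \<not> 3 dvd a)"

definition prime_full :: "nat set \<Rightarrow> nat set \<Rightarrow> bool" where
  "prime_full P A \<longleftrightarrow> (\<forall>a\<in>A. prime_factors a \<subseteq> P)"

end

theory Submission
  imports Defs
begin

text \<open>
  Fix odd numbers \<open>d\<^sub>1, \<dots>, d\<^sub>k\<close> with a common multiple \<open>M\<close>, and consider finite sets of numbers
  \<open>2\<^sup>i d\<^sub>j\<close>: with odd parts \<open>1, 5, 25, 125\<close> they are \<open>{2, 5}\<close>-full, with odd parts \<open>1, 5, 7, 35\<close>
  they are \<open>3\<close>-free.  Splitting such a set \<open>A\<close> into its odd members \<open>Q\<close> and its even members
  \<open>2A'\<close> relates the pair (sum of reciprocals, sum) \<open>= (R/M, n)\<close> of \<open>A\<close> to the pair of \<open>A'\<close>: if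
  \<open>s = \<Sum>Q\<close> and \<open>w = \<Sum>d\<in>Q. M/d\<close>, then \<open>A'\<close> has the pair \<open>(2(R - w)/M, (n - s)/2)\<close>.  Only finitely
  many values of \<open>R\<close> can occur, and each step about halves \<open>n\<close>.  So the pairs that are attained form a
  kind of automaton reading the binary digits of \<open>n\<close>, with the numerators \<open>R\<close> as states.

  Two things finish the proof.  There is a small set of numerators such that, from each of them and
  for either parity of \<open>n\<close>, some choice of \<open>Q\<close> leads back into the set; hence, if these numerators are
  attained with all \<open>n\<close> of the right residue mod 3 in an interval \<open>[N, B)\<close> with \<open>B\<close> slightly above
  \<open>2N\<close>, they are attained with all larger \<open>n\<close> as well (\<open>attained_from_certificate\<close>).  And the
  interval itself is checked by computing, inside the logic, a table of attained pairs
  (\<open>table_sound\<close>), which is obtained by going from \<open>A'\<close> to \<open>A\<close> ten or thirteen times.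

  The residue condition is natural: as \<open>d\<^sup>2 \<equiv> 1\<close>, a sum of reciprocals of numbers prime to 3
  is congruent mod 3 to the sum of the numbers, so \<open>R/M \<equiv> n\<close>.  For both values of \<open>M\<close> used here, 35
  and 125, this reads \<open>n + R \<equiv> 0\<close>.

  The odd parts \<open>1, 5, 25, 125\<close> give all \<open>n \<ge> 3634\<close>.  The odd parts \<open>1, 5, 7, 35\<close> give all
  \<open>n \<ge> 154\<close> except twelve, for which a partition involving multiples of 11, 13 or 25 is written down.
\<close>

section \<open>Sets of numbers with prescribed odd parts\<close>

definition dyadic_multiples :: "nat list \<Rightarrow> nat set" where
  "dyadic_multiples ds = {2 ^ i * d | i d. d \<in> set ds}"

definition attained :: "nat \<Rightarrow> nat list \<Rightarrow> nat \<Rightarrow> nat \<Rightarrow> bool" where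
  "attained M ds R n \<longleftrightarrow> (\<exists>A. finite A \<and> A \<subseteq> dyadic_multiples ds \<and> \<Sum>A = n \<and>
     (\<Sum>a\<in>A. 1 / rat_of_nat a) = of_nat R / of_nat M)"

text \<open>The pairs \<open>(s, w)\<close> of the possible sets \<open>Q\<close> of odd members.\<close>

definition options :: "nat \<Rightarrow> nat list \<Rightarrow> (nat \<times> nat) list" where
  "options M ds = map (\<lambda>xs. (sum_list xs, sum_list (map (\<lambda>d. M div d) xs))) (subseqs ds)"

locale odd_parts =
  fixes M :: nat and ds :: "nat list"
  assumes distinct_parts: "distinct ds"
    and M_pos: "M > 0"
    and odd_part: "d \<in> set ds \<Longrightarrow> odd d"
    and part_dvd: "d \<in> set ds \<Longrightarrow> d dvd M"
begin

lemma options_subset: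
  assumes "(s, w) \<in> set (options M ds)"
  obtains Q where "Q \<subseteq> set ds" "\<Sum>Q = s" "(\<Sum>d\<in>Q. M div d) = w"
proof -
  from assms obtain xs where xs: "xs \<in> set (subseqs ds)"
    and s: "s = sum_list xs" and w: "w = sum_list (map (\<lambda>d. M div d) xs)"
    by (auto simp: options_def)
  have "distinct xs"
    using xs distinct_parts by (rule subseqs_distinctD)
  moreover have "set xs \<subseteq> set ds"
    using xs subseqs_powset[of ds] by blast
  ultimately show thesis
    using that[of "set xs"] s w
    by (simp add: sum_list_distinct_conv_sum_set distinct_sum_list_conv_Sum)
qed

lemma attained_zero: "attained M ds 0 0"
  unfolding attained_def by (intro exI[of _ "{}"]) simp

text \<open>From \<open>A'\<close> to \<open>A = Q \<union> 2A'\<close>; the union is disjoint because of parity.\<close>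

lemma attained_step:
  assumes "attained M ds (2 * i) m" and "(s, w) \<in> set (options M ds)"
  shows "attained M ds (i + w) (2 * m + s)"
proof -
  from assms(1) obtain A where A: "finite A" "A \<subseteq> dyadic_multiples ds" "\<Sum>A = m"
    and recA: "(\<Sum>a\<in>A. 1 / rat_of_nat a) = of_nat (2 * i) / of_nat M"
    by (auto simp: attained_def)
  from assms(2) obtain Q where Q: "Q \<subseteq> set ds" "\<Sum>Q = s" "(\<Sum>d\<in>Q. M div d) = w"
    by (rule options_subset)
  let ?D = "(*) 2 ` A"
  have finQ: "finite Q"
    using Q(1) finite_subset by blast
  have disj: "Q \<inter> ?D = {}"
    using Q(1) odd_part by fastforce
  have inj: "inj_on ((*) (2::nat)) A"
    by (auto simp: inj_on_def)
  have "?D \<subseteq> dyadic_multiples ds"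
  proof
    fix x assume "x \<in> ?D"
    then obtain i d where "x = 2 * (2 ^ i * d)" "d \<in> set ds"
      using A(2) by (auto simp: dyadic_multiples_def)
    then have "x = 2 ^ Suc i * d" by simp
    with \<open>d \<in> set ds\<close> show "x \<in> dyadic_multiples ds"
      unfolding dyadic_multiples_def by blast
  qed
  moreover have "Q \<subseteq> dyadic_multiples ds"
  proof
    fix d assume "d \<in> Q"
    with Q(1) have "d = 2 ^ 0 * d" "d \<in> set ds" by auto
    then show "d \<in> dyadic_multiples ds"
      unfolding dyadic_multiples_def by blast
  qed
  moreover have "\<Sum>(Q \<union> ?D) = 2 * m + s"
    using disj finQ A Q(2)
    by (simp add: sum.union_disjoint sum.reindex[OF inj] sum_distrib_left[symmetric])
  moreover have "(\<Sum>a\<in>Q \<union> ?D. 1 / rat_of_nat a) = of_nat (i + w) / of_nat M"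
  proof -
    have "1 / rat_of_nat d = of_nat (M div d) / of_nat M" if "d \<in> Q" for d
    proof -
      have "d dvd M" using that Q(1) part_dvd by blast
      then obtain k where k: "M = d * k" by (auto elim: dvdE)
      with M_pos have "d > 0" "k > 0" by auto
      with k show ?thesis by simp
    qed
    then have "(\<Sum>d\<in>Q. 1 / rat_of_nat d) = (\<Sum>d\<in>Q. of_nat (M div d) / of_nat M)"
      by (rule sum.cong[OF refl])
    also have "\<dots> = of_nat w / of_nat M"
      using Q(3) by (simp add: sum_divide_distrib[symmetric] of_nat_sum[symmetric] del: of_nat_sum)
    finally have recQ: "(\<Sum>d\<in>Q. 1 / rat_of_nat d) = of_nat w / of_nat M" .
    have "(\<Sum>a\<in>?D. 1 / rat_of_nat a) = (\<Sum>a\<in>A. 1 / rat_of_nat a) / 2"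
      by (subst sum.reindex[OF inj]) (simp add: sum_divide_distrib mult.commute)
    also have "\<dots> = of_nat i / of_nat M"
      using recA by simp
    finally show ?thesis
      using recQ disj finQ A(1) by (simp add: sum.union_disjoint add_divide_distrib)
  qed
  ultimately show ?thesis
    unfolding attained_def using finQ A(1) by (intro exI[of _ "Q \<union> ?D"]) simp
qed

end

section \<open>A table of attained pairs\<close>

text \<open>
  The table has one column for each numerator \<open>R\<close>.  A column is a set of numbers \<open>n\<close>, written as a
  string of bits with \<open>n = 0\<close> first.  Laid out like this, one step of the recursion shifts whole
  columns and forms unions of them: an option \<open>(s, w)\<close> moves column \<open>2i\<close> to column \<open>i + w\<close> and takes
  \<open>m\<close> to \<open>2m + s\<close>, where even and odd \<open>s\<close> contribute to the even and to the odd positions of the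
  new column.  With a datatype of bit strings, one rewrite step handles one bit.
\<close>

datatype bits = E | Z bits | I bits

fun lit :: "bits \<Rightarrow> nat \<Rightarrow> bool" where
  "lit E n = False"
| "lit (Z b) n = (case n of 0 \<Rightarrow> False | Suc m \<Rightarrow> lit b m)"
| "lit (I b) n = (case n of 0 \<Rightarrow> True | Suc m \<Rightarrow> lit b m)"

text \<open>
  The length of the first argument is kept here.  It bounds the range of \<open>n\<close>, and an empty first
  argument switches off a column that is not wanted.
\<close>

fun union :: "bits \<Rightarrow> bits \<Rightarrow> bits" where
  "union E y = E"
| "union (Z x) E = Z x"
| "union (I x) E = I x"
| "union (Z x) (Z y) = Z (union x y)"
| "union (Z x) (I y) = I (union x y)"
| "union (I x) (Z y) = I (union x y)"
| "union (I x) (I y) = I (union x y)"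

fun union_shifted :: "nat \<Rightarrow> bits \<Rightarrow> bits \<Rightarrow> bits" where
  "union_shifted 0 x y = union x y"
| "union_shifted (Suc k) E y = E"
| "union_shifted (Suc k) (Z x) y = Z (union_shifted k x y)"
| "union_shifted (Suc k) (I x) y = I (union_shifted k x y)"

fun merge :: "bits \<Rightarrow> bits \<Rightarrow> bits" where
  "merge E y = E"
| "merge (Z x) E = E"
| "merge (I x) E = E"
| "merge (Z x) (Z y) = Z (Z (merge x y))"
| "merge (Z x) (I y) = Z (I (merge x y))"
| "merge (I x) (Z y) = I (Z (merge x y))"
| "merge (I x) (I y) = I (I (merge x y))"

fun zeros :: "nat \<Rightarrow> bits" where
  "zeros 0 = Z E"
| "zeros (Suc k) = merge (zeros k) (zeros k)"

fun column :: "bits list \<Rightarrow> nat \<Rightarrow> bits" where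
  "column [] R = E"
| "column (b # T) 0 = b"
| "column (b # T) (Suc R) = column T R"

fun every_other :: "bits list \<Rightarrow> bits list" where
  "every_other [] = []"
| "every_other [x] = [x]"
| "every_other (x # y # zs) = x # every_other zs"

fun add_columns :: "nat \<Rightarrow> nat \<Rightarrow> bits list \<Rightarrow> bits list \<Rightarrow> bits list" where
  "add_columns k w [] ys = []"
| "add_columns k (Suc w) (x # xs) ys = x # add_columns k w xs ys"
| "add_columns k 0 (x # xs) [] = x # xs"
| "add_columns k 0 (x # xs) (y # ys) = union_shifted k x y # add_columns k 0 xs ys"

fun merges :: "bits list \<Rightarrow> bits list \<Rightarrow> bits list" where
  "merges [] ys = []"
| "merges (x # xs) [] = []"
| "merges (x # xs) (y # ys) = merge x y # merges xs ys"

fun frame :: "bits \<Rightarrow> bits \<Rightarrow> bits list" where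
  "frame E z = []"
| "frame (Z m) z = E # frame m z"
| "frame (I m) z = z # frame m z"

fun combine :: "(nat \<times> nat) list \<Rightarrow> bits list \<Rightarrow> bits list \<Rightarrow> bits list" where
  "combine [] T base = base"
| "combine ((k, w) # opts) T base = add_columns k w (combine opts T base) T"

definition next_table ::
    "(nat \<times> nat) list \<Rightarrow> (nat \<times> nat) list \<Rightarrow> bits list \<Rightarrow> bits list \<Rightarrow> bits list" where
  "next_table es os base T = merges (combine es T base) (combine os T base)"

text \<open>
  The two lists of options are for even and for odd \<open>n\<close>, with \<open>n div 2\<close> instead of \<open>n\<close>.  Each entry of
  the last list is one step of the recursion (the first entry is the last step) and tells which
  columns to compute in it.  Only columns with even index are used by the next step.
\<close>

fun table :: "(nat \<times> nat) list \<Rightarrow> (nat \<times> nat) list \<Rightarrow> bits list \<Rightarrow> bits list" where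
  "table es os [] = [I E]"
| "table es os (m # ms) =
    next_table es os (frame m (zeros (length ms))) (every_other (table es os ms))"

lemma lit_union: "lit (union x y) n \<Longrightarrow> lit x n \<or> lit y n"
  by (induction x y arbitrary: n rule: union.induct) (auto split: nat.splits)

lemma lit_union_shifted:
  "lit (union_shifted k x y) n \<Longrightarrow> lit x n \<or> k \<le> n \<and> lit y (n - k)"
  by (induction k x y arbitrary: n rule: union_shifted.induct)
    (auto split: nat.splits dest: lit_union)

lemma lit_merge: "lit (merge x y) n \<Longrightarrow> lit (if even n then x else y) (n div 2)"
proof (induction x y arbitrary: n rule: merge.induct)
  case (4 x y)
  from 4(2) show ?case by (auto split: nat.splits if_splits dest!: 4(1))
next
  case (5 x y)
  from 5(2) show ?case by (auto split: nat.splits if_splits dest!: 5(1))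
next
  case (6 x y)
  from 6(2) show ?case by (auto split: nat.splits if_splits dest!: 6(1))
next
  case (7 x y)
  from 7(2) show ?case by (auto split: nat.splits if_splits dest!: 7(1))
qed auto

lemma not_lit_zeros: "\<not> lit (zeros k) n"
proof (induction k arbitrary: n)
  case 0
  then show ?case by (simp split: nat.split)
next
  case (Suc k)
  then show ?case using lit_merge[of "zeros k" "zeros k" n] by (auto split: if_splits)
qed

lemma column_every_other: "column (every_other T) i = column T (2 * i)"
proof (induction T arbitrary: i rule: every_other.induct)
  case (2 x)
  then show ?case by (cases i) auto
next
  case (3 x y zs)
  then show ?case by (cases i) auto
qed simp

lemma lit_add_columns:
  "lit (column (add_columns k w xs ys) R) n \<Longrightarrow>
    lit (column xs R) n \<or> w \<le> R \<and> k \<le> n \<and> lit (column ys (R - w)) (n - k)"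
proof (induction k w xs ys arbitrary: R rule: add_columns.induct)
  case (2 k w x xs ys)
  then show ?case by (cases R) auto
next
  case (4 k x xs y ys)
  then show ?case by (cases R) (auto dest: lit_union_shifted)
qed auto

lemma lit_combine:
  "lit (column (combine opts T base) R) n \<Longrightarrow>
    lit (column base R) n \<or>
    (\<exists>(k, w) \<in> set opts. w \<le> R \<and> k \<le> n \<and> lit (column T (R - w)) (n - k))"
proof (induction opts T base rule: combine.induct)
  case (2 k w opts T base)
  then show ?case by (auto dest!: lit_add_columns)
qed simp

lemma lit_merges:
  "lit (column (merges xs ys) R) n \<Longrightarrow> lit (column (if even n then xs else ys) R) (n div 2)"
proof (induction xs ys arbitrary: R rule: merges.induct)
  case (3 x xs y ys)
  then show ?case by (cases R) (auto dest: lit_merge split: if_splits)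
qed auto

lemma lit_frame: "lit (column (frame m z) R) n \<Longrightarrow> lit z n"
proof (induction m arbitrary: R)
  case (Z m)
  then show ?case by (cases R) auto
next
  case (I m)
  then show ?case by (cases R) auto
qed simp

lemma lit_next_table:
  assumes "lit (column (next_table es os (frame m (zeros l)) T) R) n"
  shows "\<exists>(k, w) \<in> set (if even n then es else os).
    w \<le> R \<and> k \<le> n div 2 \<and> lit (column T (R - w)) (n div 2 - k)"
proof -
  let ?base = "frame m (zeros l)"
  have "lit (column (combine (if even n then es else os) T ?base) R) (n div 2)"
    using lit_merges[OF assms[unfolded next_table_def]] by (simp split: if_splits)
  then show ?thesis
    using lit_combine[of "if even n then es else os" T ?base R "n div 2"]
      lit_frame[of m "zeros l" R "n div 2"] not_lit_zeros[of l "n div 2"]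
    by blast
qed

definition options_even :: "nat \<Rightarrow> nat list \<Rightarrow> (nat \<times> nat) list" where
  "options_even M ds = [(s div 2, w). (s, w) \<leftarrow> options M ds, even s]"

definition options_odd :: "nat \<Rightarrow> nat list \<Rightarrow> (nat \<times> nat) list" where
  "options_odd M ds = [(s div 2, w). (s, w) \<leftarrow> options M ds, odd s]"

context odd_parts
begin

lemma table_sound:
  "lit (column (table (options_even M ds) (options_odd M ds) ms) R) n \<Longrightarrow> attained M ds R n"
proof (induction ms arbitrary: R n)
  case Nil
  then have "R = 0 \<and> n = 0"
    by (cases R; cases n) auto
  then show ?case by (simp add: attained_zero)
next
  case (Cons m ms)
  let ?T = "table (options_even M ds) (options_odd M ds) ms"
  obtain k w where kw: "(k, w) \<in> set (if even n then options_even M ds else options_odd M ds)"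
    and le: "w \<le> R" "k \<le> n div 2"
    and lit: "lit (column ?T (2 * (R - w))) (n div 2 - k)"
    using lit_next_table[OF Cons.prems[unfolded table.simps]]
    by (auto simp: column_every_other)
  from kw obtain s where s: "(s, w) \<in> set (options M ds)" "k = s div 2" "even s = even n"
    by (auto simp: options_even_def options_odd_def split: if_splits)
  have "attained M ds (R - w + w) (2 * (n div 2 - k) + s)"
    using attained_step[OF Cons.IH[OF lit] s(1)] .
  moreover have "2 * (n div 2 - k) + s = n"
  proof -
    have "s mod 2 = n mod 2"
      using s(3) by (simp add: mod2_eq_if)
    then show ?thesis
      using s(2) le(2) div_mult_mod_eq[of n 2] div_mult_mod_eq[of s 2] by linarith
  qed
  ultimately show ?case using le(1) by simp
qed

end

section \<open>From an interval to all large numbers\<close>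

text \<open>
  A claim \<open>(R, a, c, X)\<close> says that the numerator \<open>R\<close> is attained with the \<open>c\<close> numbers
  \<open>a, a + 3, a + 6, \<dots>\<close>, except perhaps with those in \<open>X\<close>.
\<close>

type_synonym claim = "nat \<times> nat \<times> nat \<times> nat list"

fun insert_bit :: "nat \<Rightarrow> bits \<Rightarrow> bits" where
  "insert_bit k E = E"
| "insert_bit 0 (Z b) = I b"
| "insert_bit 0 (I b) = I b"
| "insert_bit (Suc k) (Z b) = Z (insert_bit k b)"
| "insert_bit (Suc k) (I b) = I (insert_bit k b)"

fun insert_bits :: "nat list \<Rightarrow> bits \<Rightarrow> bits" where
  "insert_bits [] b = b"
| "insert_bits (x # xs) b = insert_bit x (insert_bits xs b)"

fun drop_bits :: "nat \<Rightarrow> bits \<Rightarrow> bits" where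
  "drop_bits 0 b = b"
| "drop_bits (Suc k) E = E"
| "drop_bits (Suc k) (Z b) = drop_bits k b"
| "drop_bits (Suc k) (I b) = drop_bits k b"

fun every_third :: "nat \<Rightarrow> bits \<Rightarrow> bool" where
  "every_third 0 b = True"
| "every_third (Suc k) E = False"
| "every_third (Suc k) (Z b) = False"
| "every_third (Suc k) (I b) = every_third k (drop_bits (Suc (Suc 0)) b)"

fun confirms :: "bits list \<Rightarrow> claim list \<Rightarrow> bool" where
  "confirms T [] = True"
| "confirms T ((R, a, c, X) # cs) =
    (every_third c (drop_bits a (insert_bits X (column T R))) \<and> confirms T cs)"

lemma lit_insert_bit: "lit (insert_bit x b) n \<Longrightarrow> n = x \<or> lit b n"
  by (induction x b arbitrary: n rule: insert_bit.induct) (auto split: nat.splits)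

lemma lit_insert_bits: "lit (insert_bits xs b) n \<Longrightarrow> n \<in> set xs \<or> lit b n"
  by (induction xs) (auto dest: lit_insert_bit)

lemma lit_drop_bits: "lit (drop_bits k b) n = lit b (k + n)"
  by (induction k b arbitrary: n rule: drop_bits.induct) auto

lemma lit_every_third: "every_third c b \<Longrightarrow> j < c \<Longrightarrow> lit b (3 * j)"
proof (induction c b arbitrary: j rule: every_third.induct)
  case (4 k b)
  show ?case
  proof (cases j)
    case 0
    then show ?thesis by simp
  next
    case (Suc i)
    then have "lit (drop_bits (Suc (Suc 0)) b) (3 * i)"
      using 4 by simp
    then have "lit b (2 + 3 * i)"
      by (simp only: lit_drop_bits) (simp add: numeral_eq_Suc)
    then show ?thesis using Suc by simp
  qed
qed auto

lemma confirmed_claim: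
  assumes "confirms T cs" and "(R, a, c, X) \<in> set cs" and "j < c"
  shows "a + 3 * j \<in> set X \<or> lit (column T R) (a + 3 * j)"
  using assms
proof (induction T cs rule: confirms.induct)
  case (2 T R' a' c' X' cs)
  show ?case
  proof (cases "(R, a, c, X) = (R', a', c', X')")
    case True
    with 2 have "every_third c (drop_bits a (insert_bits X (column T R)))" by simp
    from lit_every_third[OF this \<open>j < c\<close>] show ?thesis
      unfolding lit_drop_bits by (rule lit_insert_bits)
  next
    case False
    with 2 show ?thesis by auto
  qed
qed simp

text \<open>
  The claims cover \<open>[N, B)\<close>, and from each of their numerators and for either parity of \<open>n\<close> some
  option leads to a numerator that again has a claim.  The bound \<open>2 * N + s \<le> B\<close> ensures that a step
  from \<open>n \<ge> B\<close> does not jump below \<open>N\<close>.  The condition on \<open>s + w\<close> makes a step preserve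
  \<open>n + R \<equiv> 0\<close> mod 3; every option satisfies it if \<open>M \<equiv> 2\<close>, because then \<open>M/d \<equiv> 2d\<close>.
\<close>

definition self_sustaining ::
    "(nat \<times> nat) list \<Rightarrow> nat \<Rightarrow> nat \<Rightarrow> claim list \<Rightarrow> bool" where
  "self_sustaining opts N B cs \<longleftrightarrow> 0 < N \<and>
    (\<forall>(R, a, c, X) \<in> set cs. a \<le> N \<and> (a + R) mod 3 = 0 \<and> B \<le> a + 3 * c \<and> (\<forall>x \<in> set X. x < N) \<and>
      (\<forall>p \<in> {0, 1}. \<exists>(s, w) \<in> set opts. s mod 2 = p \<and> 2 * N + s \<le> B \<and> w \<le> R \<and>
        (s + w) mod 3 = 0 \<and> (\<exists>(R', _) \<in> set cs. R' = 2 * (R - w))))"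

context odd_parts
begin

text \<open>Beyond \<open>B\<close> this is strong induction: a step about halves \<open>n\<close>, but stays above \<open>N\<close>.\<close>

theorem attained_from_certificate:
  assumes confirmed: "confirms (table (options_even M ds) (options_odd M ds) ms) cs"
    and sustaining: "self_sustaining (options M ds) N B cs"
    and "(R, a, c, X) \<in> set cs" and "a \<le> n" and "(n + R) mod 3 = 0" and "n \<notin> set X"
  shows "attained M ds R n"
  using assms(3-)
proof (induction n arbitrary: R a c X rule: less_induct)
  case (less n)
  have "N > 0"
    using sustaining by (simp add: self_sustaining_def)
  note claim_R = sustaining[unfolded self_sustaining_def, THEN conjunct2, rule_format,
      OF less.prems(1), simplified prod.case]
  have claim: "a \<le> N" "(a + R) mod 3 = 0" "B \<le> a + 3 * c"
    and option_R: "\<forall>p \<in> {0, 1}. \<exists>(s, w) \<in> set (options M ds). s mod 2 = p \<and> 2 * N + s \<le> B \<and>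
      w \<le> R \<and> (s + w) mod 3 = 0 \<and> (\<exists>(R', _) \<in> set cs. R' = 2 * (R - w))"
    using claim_R by - (elim conjE, assumption)+
  show ?case
  proof (cases "n < B")
    case True
    obtain j where j: "n = a + 3 * j"
    proof -
      have "3 dvd (n + R) - (a + R)"
        using less.prems(2,3) claim(2) mod_eq_dvd_iff_nat[of "a + R" "n + R" 3] by simp
      then obtain j where "n - a = 3 * j" by (auto elim: dvdE)
      with less.prems(2) have "n = a + 3 * j" by simp
      then show thesis by (rule that)
    qed
    with True claim(3) have "j < c" by linarith
    then have "lit (column (table (options_even M ds) (options_odd M ds) ms) R) n"
      using confirmed_claim[OF confirmed less.prems(1), of j] j less.prems(4) by simp
    then show ?thesis by (rule table_sound)
  next
    case False
    obtain s w R' rest where sw: "(s, w) \<in> set (options M ds)" "s mod 2 = n mod 2"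
        "2 * N + s \<le> B" "w \<le> R" "(s + w) mod 3 = 0"
      and rest: "(R', rest) \<in> set cs" and R'_eq: "R' = 2 * (R - w)"
    proof -
      have "n mod 2 \<in> {0, 1}" by auto
      from bspec[OF option_R this] show thesis
        by (elim bexE case_prodE conjE) (metis that)
    qed
    obtain a' c' X' where R': "(R', a', c', X') \<in> set cs"
      using rest by (cases rest) blast
    define m where "m = (n - s) div 2"
    have n: "n = 2 * m + s"
    proof -
      have "s \<le> n" using sw(3) False by linarith
      moreover from this have "2 dvd n - s"
        using sw(2) mod_eq_dvd_iff_nat[of s n 2] by simp
      ultimately show ?thesis by (simp add: m_def)
    qed
    have "N \<le> m"
      using n sw(3) False by linarith
    have "m < n"
      using n \<open>N \<le> m\<close> \<open>N > 0\<close> by linarith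
    have bounds: "a' \<le> N" "\<forall>x \<in> set X'. x < N"
      using sustaining R' by (auto simp: self_sustaining_def)
    have "(m + R') mod 3 = 0"
    proof -
      define r where "r = R - w"
      have "R = r + w" using sw(4) r_def by simp
      with less.prems(3) n have "3 dvd (2 * m + r) + (s + w)"
        by (simp add: ac_simps mod_0_imp_dvd)
      moreover have "3 dvd s + w"
        using sw(5) by (rule mod_0_imp_dvd)
      ultimately have "3 dvd 2 * m + r"
        by (simp only: dvd_add_left_iff)
      then have "3 dvd 2 * (2 * m + r)"
        by (rule dvd_mult)
      also have "2 * (2 * m + r) = 3 * m + (m + 2 * r)" by simp
      finally have "(m + 2 * r) mod 3 = 0"
        by (simp only: dvd_add_right_iff[OF dvd_triv_left] dvd_imp_mod_0)
      then show ?thesis using R'_eq r_def by simp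
    qed
    then have "attained M ds R' m"
      using less.IH[OF \<open>m < n\<close> R'] bounds \<open>N \<le> m\<close> by fastforce
    then have "attained M ds (R - w + w) (2 * m + s)"
      unfolding R'_eq using sw(1) by (rule attained_step)
    then show ?thesis using n sw(4) by simp
  qed
qed

end

section \<open>The two certificates\<close>

fun stripes :: "nat \<Rightarrow> bits" where
  "stripes 0 = E"
| "stripes (Suc k) = I (Z (stripes k))"

fun blank :: "nat \<Rightarrow> bits" where
  "blank 0 = E"
| "blank (Suc k) = Z (blank k)"

text \<open>
  Numerals are turned into iterated successors, so that every function above unfolds by its own
  equations only.
\<close>

lemmas table_rules =
  union.simps union_shifted.simps merge.simps zeros.simps column.simps every_other.simps
  add_columns.simps merges.simps frame.simps combine.simps next_table_def table.simps
  insert_bit.simps insert_bits.simps drop_bits.simps every_third.simps confirms.simps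
  stripes.simps blank.simps replicate.simps list.size(3) length_Cons simp_thms
  numeral_eq_Suc pred_numeral_simps Num.BitM.simps One_nat_def

interpretation odd_parts_35: odd_parts 35 "[1, 5, 7, 35]"
  by unfold_locales auto

text \<open>
  The first claim is the one that is wanted, since \<open>R = M\<close> means reciprocals with sum 1.  The numerators
  of the other claims are a set that sustains itself and that \<open>R = M\<close> leads into.
\<close>

definition claims_35 :: "claim list" where
  "claims_35 =
    [(35, 154, 253, [157, 178, 181, 187, 196, 205, 214, 232, 295, 313, 331, 349]),
     (26, 433, 160, []), (36, 432, 161, []), (60, 432, 161, []), (70, 431, 161, [])]"

lemma options_35:
  "options 35 [1, 5, 7, 35] =
    [(48, 48), (13, 47), (41, 43), (6, 42), (43, 41), (8, 40), (36, 36), (1, 35),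
     (47, 13), (12, 12), (40, 8), (5, 7), (42, 6), (7, 5), (35, 1), (0, 0)]"
  by (simp add: options_def Let_def)

lemma options_even_35:
  "options_even 35 [1, 5, 7, 35] =
    [(24, 48), (3, 42), (4, 40), (18, 36), (6, 12), (20, 8), (21, 6), (0, 0)]"
  unfolding options_even_def options_35 by simp

lemma options_odd_35:
  "options_odd 35 [1, 5, 7, 35] =
    [(6, 47), (20, 43), (21, 41), (0, 35), (23, 13), (2, 7), (3, 5), (17, 1)]"
  unfolding options_odd_def options_35 by simp

text \<open>
  Each step doubles the range of \<open>n\<close>, and \<open>2\<^sup>1\<^sup>0\<close> exceeds all numbers in the claims.  All reciprocals
  of the dyadic multiples add up to \<open>2 \<cdot> 48/35\<close>, so the even columns below 98 are all that matter
  before the last step, which only computes the columns named in the claims.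
\<close>

lemma confirms_35:
  "confirms (table (options_even 35 [1, 5, 7, 35]) (options_odd 35 [1, 5, 7, 35])
     (insert_bits [26, 35, 36, 60, 70] (blank 71) # replicate 9 (stripes 49))) claims_35"
  unfolding options_even_35 options_odd_35 claims_35_def
  by (simp only: table_rules)

lemma self_sustaining_35: "self_sustaining (options 35 [1, 5, 7, 35]) 433 913 claims_35"
  unfolding options_35 claims_35_def self_sustaining_def by simp

interpretation odd_parts_125: odd_parts 125 "[1, 5, 25, 125]"
  by unfold_locales auto

definition claims_125 :: "claim list" where
  "claims_125 =
    [(125, 3634, 1225, []), (50, 3637, 1224, []), (100, 3638, 1224, []), (150, 3639, 1224, []),
     (180, 3639, 1224, []), (200, 3637, 1224, []), (230, 3637, 1224, []), (240, 3639, 1224, []),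
     (250, 3638, 1224, [])]"

lemma options_125:
  "options 125 [1, 5, 25, 125] =
    [(156, 156), (31, 155), (131, 151), (6, 150), (151, 131), (26, 130), (126, 126), (1, 125),
     (155, 31), (30, 30), (130, 26), (5, 25), (150, 6), (25, 5), (125, 1), (0, 0)]"
  by (simp add: options_def Let_def)

lemma options_even_125:
  "options_even 125 [1, 5, 25, 125] =
    [(78, 156), (3, 150), (13, 130), (63, 126), (15, 30), (65, 26), (75, 6), (0, 0)]"
  unfolding options_even_def options_125 by simp

lemma options_odd_125:
  "options_odd 125 [1, 5, 25, 125] =
    [(15, 155), (65, 151), (75, 131), (0, 125), (77, 31), (2, 25), (12, 5), (62, 1)]"
  unfolding options_odd_def options_125 by simp

lemma self_sustaining_125: "self_sustaining (options 125 [1, 5, 25, 125]) 3639 7309 claims_125"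
  unfolding options_125 claims_125_def self_sustaining_def by simp

text \<open>Here \<open>2\<^sup>1\<^sup>3\<close> is the range needed, and all reciprocals add up to \<open>2 \<cdot> 156/125\<close>.\<close>

lemma confirms_125:
  "confirms (table (options_even 125 [1, 5, 25, 125]) (options_odd 125 [1, 5, 25, 125])
     (insert_bits [50, 100, 125, 150, 180, 200, 230, 240, 250] (blank 251)
       # replicate 12 (stripes 157))) claims_125"
  unfolding options_even_125 options_odd_125 claims_125_def
  by (simp only: table_rules)

section \<open>Partitions\<close>

text \<open>Found by the same recursion with the odd parts 11, 13, 25, 55, 65 and 77 admitted.\<close>

lemma exceptional_partitions:
  assumes "n \<in> {157, 178, 181, 187, 196, 205, 214, 232, 295, 313, 331, 349}"
  shows "\<exists>A. one_partition n A \<and> three_free A"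
proof -
  have
    "one_partition 157 {2, 4, 8, 11, 44, 88}"
    "one_partition 178 {2, 5, 8, 11, 20, 44, 88}"
    "one_partition 181 {2, 5, 7, 14, 25, 28, 100}"
    "one_partition 187 {2, 5, 10, 11, 14, 35, 110}"
    "one_partition 196 {2, 5, 8, 11, 20, 40, 110}"
    "one_partition 205 {2, 4, 8, 14, 44, 56, 77}"
    "one_partition 214 {2, 5, 8, 10, 20, 65, 104}"
    "one_partition 232 {2, 8, 10, 11, 14, 20, 35, 44, 88}"
    "one_partition 295 {2, 5, 8, 10, 20, 50, 200}"
    "one_partition 313 {2, 4, 8, 14, 35, 50, 200}"
    "one_partition 331 {2, 4, 8, 11, 56, 110, 140}"
    "one_partition 349 {2, 4, 10, 16, 25, 32, 100, 160}"
    by (simp_all add: one_partition_def)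
  moreover have
    "three_free {2, 4, 8, 11, 44, 88}"
    "three_free {2, 5, 8, 11, 20, 44, 88}"
    "three_free {2, 5, 7, 14, 25, 28, 100}"
    "three_free {2, 5, 10, 11, 14, 35, 110}"
    "three_free {2, 5, 8, 11, 20, 40, 110}"
    "three_free {2, 4, 8, 14, 44, 56, 77}"
    "three_free {2, 5, 8, 10, 20, 65, 104}"
    "three_free {2, 8, 10, 11, 14, 20, 35, 44, 88}"
    "three_free {2, 5, 8, 10, 20, 50, 200}"
    "three_free {2, 4, 8, 14, 35, 50, 200}"
    "three_free {2, 4, 8, 11, 56, 110, 140}"
    "three_free {2, 4, 10, 16, 25, 32, 100, 160}"
    by (simp_all add: three_free_def)
  ultimately show ?thesis
    using assms by (elim insertE emptyE) blast+
qed

lemma one_partition_if_attained: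
  assumes "attained M ds M n" and "M > 0" and "0 \<notin> set ds"
  obtains A where "one_partition n A" "A \<subseteq> dyadic_multiples ds"
proof -
  from assms(1) obtain A where "finite A" and sub: "A \<subseteq> dyadic_multiples ds"
    and "\<Sum>A = n" and "(\<Sum>a\<in>A. 1 / rat_of_nat a) = of_nat M / of_nat M"
    by (auto simp: attained_def)
  moreover have "\<forall>a\<in>A. a > 0"
  proof
    fix a assume "a \<in> A"
    with sub obtain i d where "a = 2 ^ i * d" "d \<in> set ds"
      by (auto simp: dyadic_multiples_def)
    with assms(3) show "a > 0" by (cases d) auto
  qed
  ultimately show thesis
    using that[of A] assms(2) by (simp add: one_partition_def)
qed

lemma three_free_dyadic_multiples: "three_free (dyadic_multiples [1, 5, 7, 35])"
proof -
  have "\<not> 3 dvd 2 ^ i * d" if "d \<in> {1, 5, 7, 35}" for i d :: nat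
  proof
    have three: "prime (3::nat)" by simp
    assume "3 dvd 2 ^ i * d"
    then have "3 dvd (2::nat) \<or> 3 dvd d"
      using three prime_dvd_mult_iff prime_dvd_power by blast
    with that show False by auto
  qed
  then show ?thesis by (auto simp: three_free_def dyadic_multiples_def)
qed

lemma prime_full_dyadic_multiples: "prime_full {2, 5} (dyadic_multiples [1, 5, 25, 125])"
proof -
  have "p \<in> {2, 5}" if "d \<in> {1, 5, 25, 125}" "prime p" "p dvd 2 ^ i * d" for i d p :: nat
  proof -
    have "d dvd 5 ^ 3" using that(1) by auto
    with that(3) have "p dvd 2 ^ i * 5 ^ 3"
      by (meson dvd_trans dvd_refl mult_dvd_mono)
    then have "p dvd 2 \<or> p dvd 5"
      using that(2) prime_dvd_mult_iff prime_dvd_power by blast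
    moreover have "prime (2::nat)" "prime (5::nat)" by simp_all
    ultimately show ?thesis
      using that(2) primes_dvd_imp_eq by blast
  qed
  then show ?thesis
    by (auto simp: prime_full_def dyadic_multiples_def in_prime_factors_iff)
qed

theorem proposition3:
  fixes n :: nat
  assumes "n > 0" and "n mod 3 = 1"
  shows "(n \<ge> 154 \<longrightarrow> (\<exists>A. one_partition n A \<and> three_free A)) \<and>
         (n \<ge> 3634 \<longrightarrow> (\<exists>A. one_partition n A \<and> prime_full {2, 5} A))"
proof (intro conjI impI)
  have mod3: "(n + 35) mod 3 = 0" "(n + 125) mod 3 = 0"
    using assms(2) mod_add_left_eq[of n 3 35] mod_add_left_eq[of n 3 125] by simp_all
  show "\<exists>A. one_partition n A \<and> three_free A" if "n \<ge> 154"
  proof (cases "n \<in> set [157, 178, 181, 187, 196, 205, 214, 232, 295, 313, 331, 349]")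
    case True
    then show ?thesis by (intro exceptional_partitions) simp
  next
    case False
    have "(35, 154, 253, [157, 178, 181, 187, 196, 205, 214, 232, 295, 313, 331, 349])
        \<in> set claims_35"
      by (simp add: claims_35_def)
    from odd_parts_35.attained_from_certificate[OF confirms_35 self_sustaining_35 this that mod3(1) False]
    obtain A where "one_partition n A" "A \<subseteq> dyadic_multiples [1, 5, 7, 35]"
      by (rule one_partition_if_attained) simp_all
    then show ?thesis
      using three_free_dyadic_multiples unfolding three_free_def by blast
  qed
  show "\<exists>A. one_partition n A \<and> prime_full {2, 5} A" if "n \<ge> 3634"
  proof -
    have "(125, 3634, 1225, []) \<in> set claims_125"
      by (simp add: claims_125_def)
    from odd_parts_125.attained_from_certificate[OF confirms_125 self_sustaining_125 this that mod3(2)]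
    obtain A where "one_partition n A" "A \<subseteq> dyadic_multiples [1, 5, 25, 125]"
      by (rule one_partition_if_attained) simp_all
    then show ?thesis
      using prime_full_dyadic_multiples unfolding prime_full_def by blast
  qed
qed

end
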